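(* The family $\mathcal F$ of all finite Hasse forests is a projective Fraïssé family.
   Context: Let $\mathcal L_R=\{R,\le\}$ be a language with two binary relation symbols. A topological $\mathcal L_R$-structure is a zero-dimensional compact metrizable space $A$ together with interpretations $R^A,\le^A$ which are closed subsets of $A^2$ (finite structures carry the discrete topology). An epimorphism $\varphi:A\to B$ between topological $\mathcal L_R$-structures is a continuous surjection such that for each symbol $r\in\mathcal L_R$, $r^B=(\varphi\times\varphi)[r^A]$, i.e. $r^B(b_1,b_2)$ iff there are $a_1,a_2$ with $\varphi(a_i)=b_i$ and $r^A(a_1,a_2)$. A family $\mathcal G$ of topological $\mathcal L_R$-structures is a projective Fraïssé family if (JPP) for all $A,B\in\mathcal G$ there are $C\in\mathcal G$ and epimorphisms $C\to A$, $C\to B$; and (AP) for all $A,B,C\in\mathcal G$ and epimorphisms $\varphi_1:B\to A$, $\varphi_2:C\to A$ there are $D\in\mathcal G$ and epimorphisms $\psi_1:D\to B$, $\psi_2:D\to C$ with $\varphi_1\psi_1=\varphi_2\psi_2$. A Hasse partial order (HPO) is a topological $\mathcal L_R$-structure $P$ in which $\le^P$ is a partial order and $a\,R^P\,b$ holds iff $a=b$ or one of $a,b$ is an immediate $\le^P$-successor of the other (so $R^P$ is the Hasse diagram of $\le^P$, made reflexive). A Hasse forest is an HPO whose Hasse diagram has no cycles. $\mathcal F$ denotes the family of all finite Hasse forests. *)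

theory Defs
  imports "HOL-Analysis.Analysis" "HOL-Library.Infinite_Typeclass"
begin

definition zero_dimensional_space :: "'a topology \<Rightarrow> bool" where
  "zero_dimensional_space X \<longleftrightarrow>
     (\<forall>U x. openin X U \<and> x \<in> U \<longrightarrow>
        (\<exists>V. openin X V \<and> closedin X V \<and> x \<in> V \<and> V \<subseteq> U))"

record 'a lr_structure =
  Top :: "'a topology"
  Rel :: "('a \<times> 'a) set"
  Le :: "('a \<times> 'a) set"

abbreviation dom_of :: "'a lr_structure \<Rightarrow> 'a set" where
  "dom_of A \<equiv> topspace (Top A)"

text \<open>As usual in model theory, structures are nonempty: an empty structure would be an
  epimorphic image of no other structure, so that joint projection would fail for it.\<close>

definition topological_lr_structure :: "'a lr_structure \<Rightarrow> bool" where
  "topological_lr_structure A \<longleftrightarrow>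
     dom_of A \<noteq> {} \<and>
     zero_dimensional_space (Top A) \<and> compact_space (Top A) \<and> metrizable_space (Top A) \<and>
     closedin (prod_topology (Top A) (Top A)) (Rel A) \<and>
     closedin (prod_topology (Top A) (Top A)) (Le A)"

definition epimorphism :: "'a lr_structure \<Rightarrow> 'b lr_structure \<Rightarrow> ('a \<Rightarrow> 'b) \<Rightarrow> bool" where
  "epimorphism A B f \<longleftrightarrow>
     continuous_map (Top A) (Top B) f \<and>
     f ` dom_of A = dom_of B \<and>
     Rel B = map_prod f f ` Rel A \<and>
     Le B = map_prod f f ` Le A"

definition joint_projection_property :: "'a lr_structure set \<Rightarrow> bool" where
  "joint_projection_property \<G> \<longleftrightarrow>
     (\<forall>A\<in>\<G>. \<forall>B\<in>\<G>. \<exists>C\<in>\<G>. \<exists>f g. epimorphism C A f \<and> epimorphism C B g)"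

definition projective_amalgamation_property :: "'a lr_structure set \<Rightarrow> bool" where
  "projective_amalgamation_property \<G> \<longleftrightarrow>
     (\<forall>A\<in>\<G>. \<forall>B\<in>\<G>. \<forall>C\<in>\<G>. \<forall>\<phi>\<^sub>1 \<phi>\<^sub>2.
        epimorphism B A \<phi>\<^sub>1 \<and> epimorphism C A \<phi>\<^sub>2 \<longrightarrow>
        (\<exists>D\<in>\<G>. \<exists>\<psi>\<^sub>1 \<psi>\<^sub>2.
           epimorphism D B \<psi>\<^sub>1 \<and> epimorphism D C \<psi>\<^sub>2 \<and>
           (\<forall>d\<in>dom_of D. \<phi>\<^sub>1 (\<psi>\<^sub>1 d) = \<phi>\<^sub>2 (\<psi>\<^sub>2 d))))"

definition projective_Fraisse_family :: "'a lr_structure set \<Rightarrow> bool" where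
  "projective_Fraisse_family \<G> \<longleftrightarrow>
     (\<forall>A\<in>\<G>. topological_lr_structure A) \<and>
     joint_projection_property \<G> \<and> projective_amalgamation_property \<G>"

definition immediate_successor :: "('a \<times> 'a) set \<Rightarrow> 'a \<Rightarrow> 'a \<Rightarrow> bool" where
  "immediate_successor r a b \<longleftrightarrow>
     (a, b) \<in> r \<and> a \<noteq> b \<and> (\<forall>c. (a, c) \<in> r \<and> (c, b) \<in> r \<longrightarrow> c = a \<or> c = b)"

definition HPO :: "'a lr_structure \<Rightarrow> bool" where
  "HPO P \<longleftrightarrow>
     topological_lr_structure P \<and>
     partial_order_on (dom_of P) (Le P) \<and>
     (\<forall>a\<in>dom_of P. \<forall>b\<in>dom_of P.
        (a, b) \<in> Rel P \<longleftrightarrow>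
          a = b \<or> immediate_successor (Le P) a b \<or> immediate_successor (Le P) b a)"

text \<open>Cycles of the undirected graph underlying a symmetric relation: at least three pairwise
  distinct vertices, so loops and edges traversed back and forth do not count.\<close>

definition graph_cycle :: "('a \<times> 'a) set \<Rightarrow> 'a list \<Rightarrow> bool" where
  "graph_cycle E xs \<longleftrightarrow>
     3 \<le> length xs \<and> distinct xs \<and>
     (\<forall>i<length xs. (xs ! i, xs ! (Suc i mod length xs)) \<in> E)"

definition Hasse_forest :: "'a lr_structure \<Rightarrow> bool" where
  "Hasse_forest P \<longleftrightarrow> HPO P \<and> \<not> (\<exists>xs. graph_cycle (Rel P) xs)"

text \<open>All finite Hasse forests with elements in the type \<open>'a\<close>. If \<open>'a\<close> is infinite, this
  contains an isomorphic copy of every finite Hasse forest.\<close>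

definition finite_Hasse_forests :: "'a lr_structure set" where
  "finite_Hasse_forests = {P. Hasse_forest P \<and> finite (dom_of P)}"

text \<open>Finite structures automatically carry the discrete topology, and for them the
  topological requirements impose nothing else.\<close>

lemma finite_topological_lr_structure_iff:
  fixes A :: "'a lr_structure"
  assumes fin: "finite (dom_of A)"
  shows "topological_lr_structure A \<longleftrightarrow>
    dom_of A \<noteq> {} \<and> Top A = discrete_topology (dom_of A) \<and>
    Rel A \<subseteq> dom_of A \<times> dom_of A \<and> Le A \<subseteq> dom_of A \<times> dom_of A"
    (is "?L \<longleftrightarrow> ?R")
proof
  assume L: ?L
  then have "t1_space (Top A)"
    by (simp add: topological_lr_structure_def metrizable_imp_t1_space)
  then have "Top A = discrete_topology (dom_of A)"
    using fin by (metis finite_t1_space_imp_discrete_topology)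
  then show ?R
    using L closedin_subset unfolding topological_lr_structure_def
    by (metis topspace_prod_topology)
next
  assume R: ?R
  define U where "U = dom_of A"
  have T: "Top A = discrete_topology U" and U: "finite U" "U \<noteq> {}"
    using R fin by (auto simp: U_def)
  have "prod_topology (Top A) (Top A) = discrete_topology (U \<times> U)"
    by (simp add: T prod_topology_discrete_topology)
  moreover have "zero_dimensional_space (Top A)"
    unfolding zero_dimensional_space_def T by auto
  moreover have "compact_space (Top A)"
    using U by (simp add: T compact_space_discrete_topology)
  moreover have "metrizable_space (Top A)"
    by (simp add: T metrizable_space_discrete_topology)
  ultimately show ?L
    using R unfolding topological_lr_structure_def U_def by simp
qed

end

theory Submission
  imports Defs
begin

text \<open>
  Joint projection is amalgamation over the one-point structure. For amalgamation, let
  \<open>\<phi>\<^sub>1 : B \<rightarrow> A\<close> and \<open>\<phi>\<^sub>2 : C \<rightarrow> A\<close> be epimorphisms. In a Hasse forest an element has at most one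
  immediate successor below a given upper bound, so saturated chains with prescribed end points
  are unique. Hence a saturated chain in \<open>B\<close> and a saturated chain in \<open>C\<close> whose end points agree
  in \<open>A\<close> run, up to repetitions, through the same chain of \<open>A\<close>, and can be traversed
  simultaneously by a walk in the fibre product. Every pair \<open>b \<le> b'\<close> in \<open>B\<close> or \<open>c \<le> c'\<close> in \<open>C\<close>
  occurs as the pair of end points of such a walk, and the disjoint union of finitely many of
  these walks, each regarded as a chain, is the amalgam.
\<close>

section \<open>Finite Hasse forests\<close>

text \<open>On a finite carrier the topological conditions amount to nonemptiness, discreteness and
  relations living on the carrier, so membership becomes combinatorial.\<close>

lemma finite_Hasse_forests_iff:
  "P \<in> finite_Hasse_forests \<longleftrightarrow>
     finite (dom_of P) \<and> dom_of P \<noteq> {} \<and> Top P = discrete_topology (dom_of P) \<and>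
     Rel P \<subseteq> dom_of P \<times> dom_of P \<and> Le P \<subseteq> dom_of P \<times> dom_of P \<and>
     partial_order_on (dom_of P) (Le P) \<and>
     (\<forall>a\<in>dom_of P. \<forall>b\<in>dom_of P. (a, b) \<in> Rel P \<longleftrightarrow>
        a = b \<or> immediate_successor (Le P) a b \<or> immediate_successor (Le P) b a) \<and>
     (\<nexists>xs. graph_cycle (Rel P) xs)"
  by (auto simp: finite_Hasse_forests_def Hasse_forest_def HPO_def
      finite_topological_lr_structure_iff)

text \<open>Cycles are assembled below by concatenating paths, for which \<open>successively\<close>
  is handier than indices modulo the length; only the closing edge is left over.\<close>

lemma graph_cycleI:
  assumes "successively (\<lambda>x y. (x, y) \<in> E) xs" "(last xs, hd xs) \<in> E"
    and "distinct xs" "3 \<le> length xs"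
  shows "graph_cycle E xs"
  unfolding graph_cycle_def
proof (intro conjI allI impI)
  fix i assume i: "i < length xs"
  show "(xs ! i, xs ! (Suc i mod length xs)) \<in> E"
  proof (cases "Suc i = length xs")
    case True
    then have "xs \<noteq> []" "i = length xs - 1" by auto
    then show ?thesis
      using assms(2) True by (simp add: last_conv_nth hd_conv_nth)
  next
    case False
    then show ?thesis
      using assms(1) i by (simp add: successively_conv_nth)
  qed
qed (use assms in auto)

locale finite_Hasse_forest =
  fixes P :: "'a lr_structure"
  assumes mem: "P \<in> finite_Hasse_forests"
begin

lemmas mem_conjs = mem[unfolded finite_Hasse_forests_iff]

lemma fin: "finite (dom_of P)" and nonempty: "dom_of P \<noteq> {}"
  and Le_po: "partial_order_on (dom_of P) (Le P)"
  and acyclic: "\<not> graph_cycle (Rel P) xs"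
  using mem_conjs by simp_all

lemma Rel_dom: "(a, b) \<in> Rel P \<Longrightarrow> a \<in> dom_of P \<and> b \<in> dom_of P"
  and Le_dom: "(a, b) \<in> Le P \<Longrightarrow> a \<in> dom_of P \<and> b \<in> dom_of P"
  using mem_conjs by auto

lemma Rel_iff: "a \<in> dom_of P \<Longrightarrow> b \<in> dom_of P \<Longrightarrow> (a, b) \<in> Rel P \<longleftrightarrow>
    a = b \<or> immediate_successor (Le P) a b \<or> immediate_successor (Le P) b a"
  using mem_conjs by simp

lemma finite_Le: "finite (Le P)"
  using fin by (rule finite_subset[rotated, OF finite_cartesian_product]) (use fin Le_dom in auto)

lemma Le_refl: "a \<in> dom_of P \<Longrightarrow> (a, a) \<in> Le P"
  using Le_po unfolding partial_order_on_def preorder_on_def by (blast dest: refl_onD)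

lemma Le_trans: "(a, b) \<in> Le P \<Longrightarrow> (b, c) \<in> Le P \<Longrightarrow> (a, c) \<in> Le P"
  using Le_po unfolding partial_order_on_def preorder_on_def by (blast dest: transD)

lemma Le_antisym: "(a, b) \<in> Le P \<Longrightarrow> (b, a) \<in> Le P \<Longrightarrow> a = b"
  using Le_po unfolding partial_order_on_def by (blast dest: antisymD)

lemma Rel_refl: "a \<in> dom_of P \<Longrightarrow> (a, a) \<in> Rel P"
  using Rel_iff by blast

lemma Rel_sym: "(a, b) \<in> Rel P \<Longrightarrow> (b, a) \<in> Rel P"
  using Rel_iff Rel_dom by blast

lemma immediate_successor_Le: "immediate_successor (Le P) a b \<Longrightarrow> (a, b) \<in> Le P"
  by (simp add: immediate_successor_def)

lemma immediate_successor_Rel: "immediate_successor (Le P) a b \<Longrightarrow> (a, b) \<in> Rel P"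
  using Rel_iff Le_dom immediate_successor_Le by blast

lemma step_cases:
  assumes "(a, b) \<in> Rel P \<inter> Le P"
  shows "a = b \<or> immediate_successor (Le P) a b"
  using assms Rel_iff[of a b] Le_dom Le_antisym immediate_successor_Le by blast

lemma immediate_successor_exists:
  assumes "(a, b) \<in> Le P" "a \<noteq> b"
  obtains c where "immediate_successor (Le P) a c" "(c, b) \<in> Le P"
proof -
  let ?I = "\<lambda>c. {z. (a, z) \<in> Le P \<and> (z, c) \<in> Le P}"
  have finI: "finite (?I c)" for c
    by (rule finite_subset[OF _ fin]) (use Le_dom in auto)
  let ?Q = "\<lambda>c. (a, c) \<in> Le P \<and> a \<noteq> c \<and> (c, b) \<in> Le P"
  have "?Q b" using assms Le_refl Le_dom by blast
  \<comment> \<open>An element of \<open>?Q\<close> with the smallest interval above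
    \<open>a\<close> is an immediate successor, since an element strictly in between would have a
    smaller interval.\<close>
  then obtain c where c: "?Q c" and least: "\<And>d. ?Q d \<Longrightarrow> card (?I c) \<le> card (?I d)"
    using ex_has_least_nat[of ?Q b "\<lambda>c. card (?I c)"] by blast
  have "d = a \<or> d = c" if d: "(a, d) \<in> Le P" "(d, c) \<in> Le P" for d
  proof (rule ccontr)
    assume n: "\<not> (d = a \<or> d = c)"
    then have "?Q d" using d c Le_trans by blast
    moreover have "?I d \<subset> ?I c"
      using d n c Le_trans Le_antisym Le_refl Le_dom by blast
    then have "card (?I d) < card (?I c)" using finI psubset_card_mono by blast
    ultimately show False using least by fastforce
  qed
  then have "immediate_successor (Le P) a c" using c by (auto simp: immediate_successor_def)
  then show thesis using that c by blast
qed

text \<open>Climbing from \<open>a\<close> to the fixed \<open>b\<close> by immediate successors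
  terminates, because the finite up-set of the current element shrinks at each step.\<close>

lemma Le_induct [consumes 1, case_names base step]:
  assumes "(a, b) \<in> Le P"
    and base: "Q b"
    and step: "\<And>a c. immediate_successor (Le P) a c \<Longrightarrow> (c, b) \<in> Le P \<Longrightarrow> Q c \<Longrightarrow> Q a"
  shows "Q a"
  using assms(1)
proof (induction "card {z. (a, z) \<in> Le P}" arbitrary: a rule: less_induct)
  case less
  show ?case
  proof (cases "a = b")
    case True
    then show ?thesis using base by simp
  next
    case False
    then obtain c where c: "immediate_successor (Le P) a c" "(c, b) \<in> Le P"
      using immediate_successor_exists less.prems by blast
    have ac: "(a, c) \<in> Le P" "a \<noteq> c" using c(1) by (auto simp: immediate_successor_def)
    have "finite {z. (a, z) \<in> Le P}"
      by (rule finite_subset[OF _ fin]) (use Le_dom in auto)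
    moreover have "{z. (c, z) \<in> Le P} \<subset> {z. (a, z) \<in> Le P}"
      using ac Le_trans Le_antisym Le_refl Le_dom by blast
    ultimately have "card {z. (c, z) \<in> Le P} < card {z. (a, z) \<in> Le P}"
      using psubset_card_mono by blast
    then show ?thesis using less.hyps c step by blast
  qed
qed

text \<open>The bounds on the members are what later shows that two such chains meet only in their
  common top.\<close>

lemma saturated_chain_exists:
  assumes "(a, b) \<in> Le P"
  shows "\<exists>xs. xs \<noteq> [] \<and> hd xs = a \<and> last xs = b \<and> distinct xs \<and>
    successively (\<lambda>x y. (x, y) \<in> Rel P) xs \<and> (\<forall>z\<in>set xs. (a, z) \<in> Le P \<and> (z, b) \<in> Le P)"
  using assms
proof (induction rule: Le_induct)
  case base
  show ?case using Le_refl Le_dom assms by (intro exI[of _ "[b]"]) auto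
next
  case (step a c)
  then obtain xs where xs: "xs \<noteq> []" "hd xs = c" "last xs = b" "distinct xs"
    "successively (\<lambda>x y. (x, y) \<in> Rel P) xs" "\<forall>z\<in>set xs. (c, z) \<in> Le P \<and> (z, b) \<in> Le P"
    by blast
  have ac: "(a, c) \<in> Le P" "a \<noteq> c" using step(1) by (auto simp: immediate_successor_def)
  have "(a, a) \<in> Le P" "(a, b) \<in> Le P" "a \<notin> set xs" "\<forall>z\<in>set xs. (a, z) \<in> Le P"
    using ac xs(6) step(2) Le_refl Le_trans Le_antisym Le_dom by blast+
  moreover have "(a, c) \<in> Rel P" using step(1) by (rule immediate_successor_Rel)
  ultimately show ?case
    using xs by (intro exI[of _ "a # xs"]) (auto simp: successively_Cons)
qed

section \<open>Uniqueness of saturated chains\<close>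

text \<open>This is where acyclicity enters. If \<open>x\<close> and \<open>y\<close> differed,
  saturated chains from them to a minimal common upper bound would meet only there and would close
  up to a cycle through \<open>a\<close>.\<close>

lemma immediate_successor_unique_below:
  assumes x: "immediate_successor (Le P) a x" and y: "immediate_successor (Le P) a y"
    and u: "(x, u) \<in> Le P" "(y, u) \<in> Le P"
  shows "x = y"
proof (rule ccontr)
  assume "x \<noteq> y"
  with x y have inc: "(x, y) \<notin> Le P" "(y, x) \<notin> Le P"
    by (auto simp: immediate_successor_def)
  let ?Q = "\<lambda>q. (x, q) \<in> Le P \<and> (y, q) \<in> Le P"
  have finI: "finite {z. (z, c) \<in> Le P}" for c
    by (rule finite_subset[OF _ fin]) (use Le_dom in auto)
  \<comment> \<open>The smallest down-set makes \<open>q\<close> minimal among the common upper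
    bounds of \<open>x\<close> and \<open>y\<close>.\<close>
  obtain q where q: "?Q q"
    and least: "\<And>d. ?Q d \<Longrightarrow> card {z. (z, q) \<in> Le P} \<le> card {z. (z, d) \<in> Le P}"
    using ex_has_least_nat[of ?Q u "\<lambda>c. card {z. (z, c) \<in> Le P}"] u by blast
  have min: "d = q" if d: "?Q d" "(d, q) \<in> Le P" for d
  proof (rule ccontr)
    assume "d \<noteq> q"
    then have "{z. (z, d) \<in> Le P} \<subset> {z. (z, q) \<in> Le P}"
      using d Le_trans Le_antisym Le_refl Le_dom by blast
    then show False using least[OF d(1)] finI psubset_card_mono by (metis leD)
  qed
  obtain xs where xs: "xs \<noteq> []" "hd xs = x" "last xs = q" "distinct xs"
    "successively (\<lambda>x y. (x, y) \<in> Rel P) xs" "\<forall>z\<in>set xs. (x, z) \<in> Le P \<and> (z, q) \<in> Le P"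
    using saturated_chain_exists q by blast
  obtain ys where ys: "ys \<noteq> []" "hd ys = y" "last ys = q" "distinct ys"
    "successively (\<lambda>x y. (x, y) \<in> Rel P) ys" "\<forall>z\<in>set ys. (y, z) \<in> Le P \<and> (z, q) \<in> Le P"
    using saturated_chain_exists q by blast
  \<comment> \<open>\<open>zs\<close> is the second chain without \<open>q\<close>, so that the
    cycle lists \<open>q\<close> only once. It is nonempty, since otherwise \<open>y = q\<close>
    would lie above \<open>x\<close>.\<close>
  obtain zs where zs: "ys = zs @ [q]" using ys(1,3) by (metis append_butlast_last_id)
  have zs_ne: "zs \<noteq> []" using zs ys(2) q inc by auto
  then have hd_zs: "hd zs = y" using zs ys(2) by simp
  have a: "(a, x) \<in> Le P" "(a, y) \<in> Le P" "a \<noteq> x" "a \<noteq> y"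
    using x y by (auto simp: immediate_successor_def)
  \<comment> \<open>A common member would be a common upper bound of \<open>x\<close> and
    \<open>y\<close> below \<open>q\<close>, hence \<open>q\<close> itself, which \<open>zs\<close>
    omits.\<close>
  have disj: "set xs \<inter> set zs = {}"
    using xs(6) ys(4,6) zs min by auto
  have a_notin: "a \<notin> set xs" "a \<notin> set zs"
    using a xs(6) ys(6) zs Le_antisym by auto
  have succ_zs: "successively (\<lambda>x y. (x, y) \<in> Rel P) zs" "(last zs, q) \<in> Rel P"
    using ys(5) zs zs_ne by (auto simp: successively_append_iff)
  have succ_rev: "successively (\<lambda>x y. (x, y) \<in> Rel P) (rev zs)"
    unfolding successively_rev by (rule successively_mono[OF succ_zs(1)]) (auto intro: Rel_sym)
  \<comment> \<open>The cycle goes from \<open>a\<close> up through \<open>xs\<close> to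
    \<open>q\<close>, then down through \<open>zs\<close> to \<open>y\<close>, which is adjacent to
    \<open>a\<close>.\<close>
  have "graph_cycle (Rel P) (a # xs @ rev zs)"
  proof (rule graph_cycleI)
    show "successively (\<lambda>x y. (x, y) \<in> Rel P) (a # xs @ rev zs)"
      using xs(1,2,3,5) zs_ne succ_rev succ_zs(2) immediate_successor_Rel[OF x]
      by (auto simp: successively_Cons successively_append_iff hd_rev Rel_sym)
    show "(last (a # xs @ rev zs), hd (a # xs @ rev zs)) \<in> Rel P"
      using zs_ne hd_zs immediate_successor_Rel[OF y] by (simp add: last_rev Rel_sym)
    show "distinct (a # xs @ rev zs)"
      using xs(4) ys(4) zs disj a_notin by auto
    show "3 \<le> length (a # xs @ rev zs)"
      using xs(1) zs_ne by (cases xs; cases zs) auto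
  qed
  then show False using acyclic by blast
qed

end

section \<open>Epimorphisms\<close>

lemma epimorphism_Rel: "epimorphism A B f \<Longrightarrow> (x, y) \<in> Rel A \<Longrightarrow> (f x, f y) \<in> Rel B"
  and epimorphism_Le: "epimorphism A B f \<Longrightarrow> (x, y) \<in> Le A \<Longrightarrow> (f x, f y) \<in> Le B"
  unfolding epimorphism_def by force+

lemma epimorphism_Le_lift:
  assumes "epimorphism A B f" "(u, v) \<in> Le B"
  obtains x y where "(x, y) \<in> Le A" "f x = u" "f y = v"
  using assms unfolding epimorphism_def by auto

lemma epimorphism_discreteI:
  assumes top: "Top A = discrete_topology X"
    and dom: "\<And>x. x \<in> X \<Longrightarrow> h x \<in> dom_of B" "\<And>b. b \<in> dom_of B \<Longrightarrow> \<exists>x\<in>X. h x = b"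
    and sub: "\<And>x y. (x, y) \<in> Rel A \<Longrightarrow> (h x, h y) \<in> Rel B"
      "\<And>x y. (x, y) \<in> Le A \<Longrightarrow> (h x, h y) \<in> Le B"
    and sup: "\<And>b b'. (b, b') \<in> Rel B \<Longrightarrow> \<exists>x y. (x, y) \<in> Rel A \<and> h x = b \<and> h y = b'"
      "\<And>b b'. (b, b') \<in> Le B \<Longrightarrow> \<exists>x y. (x, y) \<in> Le A \<and> h x = b \<and> h y = b'"
  shows "epimorphism A B h"
proof -
  have eq: "S = map_prod h h ` R"
    if "\<And>x y. (x, y) \<in> R \<Longrightarrow> (h x, h y) \<in> S"
      "\<And>b b'. (b, b') \<in> S \<Longrightarrow> \<exists>x y. (x, y) \<in> R \<and> h x = b \<and> h y = b'" for R S
    using that by fastforce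
  have "h ` X = dom_of B" using dom by blast
  moreover have "continuous_map (Top A) (Top B) h" using top dom(1) by simp
  moreover have "Rel B = map_prod h h ` Rel A" using sub(1) sup(1) by (rule eq)
  moreover have "Le B = map_prod h h ` Le A" using sub(2) sup(2) by (rule eq)
  ultimately show ?thesis using top by (simp add: epimorphism_def)
qed

section \<open>Walks in the fibre product\<close>

text \<open>In Hasse forests, a pair in both \<open>Rel\<close> and \<open>Le\<close> is a pause or
  a climb to an immediate successor. Pauses are needed because chains in \<open>B\<close> and
  \<open>C\<close> may repeat the same point of \<open>A\<close> different numbers of times.\<close>

definition fibre_step ::
  "'b lr_structure \<Rightarrow> 'c lr_structure \<Rightarrow> ('b \<Rightarrow> 'a) \<Rightarrow> ('c \<Rightarrow> 'a) \<Rightarrow> (('b \<times> 'c) \<times> ('b \<times> 'c)) set"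
  where "fibre_step B C f g =
    {((b, c), (b', c')). (b, b') \<in> Rel B \<inter> Le B \<and> (c, c') \<in> Rel C \<inter> Le C \<and>
       f b = g c \<and> f b' = g c'}"

text \<open>Induction from the top in \<open>B\<close> and, inside it, in \<open>C\<close>. If the
  next step of one coordinate is collapsed in \<open>A\<close>, that coordinate moves alone.
  Otherwise both images move to immediate successors of the same point, below
  \<open>f b' = g c'\<close>; these coincide by \<open>immediate_successor_unique_below\<close>, so
  both coordinates move together.\<close>

lemma fibre_walk_exists:
  assumes A: "A \<in> finite_Hasse_forests" and B: "B \<in> finite_Hasse_forests"
    and C: "C \<in> finite_Hasse_forests"
    and f: "epimorphism B A f" and g: "epimorphism C A g"
    and b: "(b, b') \<in> Le B" and c: "(c, c') \<in> Le C"
    and start: "f b = g c" and finish: "f b' = g c'"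
  shows "((b, c), (b', c')) \<in> (fibre_step B C f g)\<^sup>*"
proof -
  interpret A: finite_Hasse_forest A by unfold_locales (rule A)
  interpret B: finite_Hasse_forest B by unfold_locales (rule B)
  interpret C: finite_Hasse_forest C by unfold_locales (rule C)
  let ?S = "fibre_step B C f g"
  note B_succ = B.immediate_successor_Rel B.immediate_successor_Le
  note C_succ = C.immediate_successor_Rel C.immediate_successor_Le
  note B_refl = B.Le_refl B.Rel_refl
  note C_refl = C.Le_refl C.Rel_refl
  have f_step: "f x = f y \<or> immediate_successor (Le A) (f x) (f y)"
    if "immediate_successor (Le B) x y" for x y
    using that B_succ A.step_cases epimorphism_Rel[OF f] epimorphism_Le[OF f] by blast
  have g_step: "g x = g y \<or> immediate_successor (Le A) (g x) (g y)"
    if "immediate_successor (Le C) x y" for x y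
    using that C_succ A.step_cases epimorphism_Rel[OF g] epimorphism_Le[OF g] by blast
  \<comment> \<open>The quantifier over \<open>c\<close> allows the outer hypothesis to be used
    after \<open>c\<close> has moved as well.\<close>
  have "\<forall>c. (c, c') \<in> Le C \<longrightarrow> f b = g c \<longrightarrow> ((b, c), (b', c')) \<in> ?S\<^sup>*"
    using b
  proof (induction rule: B.Le_induct)
    case base
    have b'_dom: "b' \<in> dom_of B" using b B.Le_dom by blast
    show ?case
    proof (intro allI impI)
      fix c assume "(c, c') \<in> Le C" "f b' = g c"
      then show "((b', c), (b', c')) \<in> ?S\<^sup>*"
      proof (induction rule: C.Le_induct)
        case base
        show ?case by simp
      next
        case (step c d)
        \<comment> \<open>\<open>g d\<close> is squeezed between \<open>g c\<close> and
          \<open>g c'\<close>, both equal to \<open>f b'\<close>.\<close>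
        have "g d = g c"
          using epimorphism_Le[OF g] step(1,2,4) finish A.Le_antisym C_succ(2) by metis
        then have "((b', c), (b', d)) \<in> ?S"
          using step(1,4) C_succ B_refl[OF b'_dom] by (auto simp: fibre_step_def)
        then show ?case
          using step \<open>g d = g c\<close> by (simp add: converse_rtrancl_into_rtrancl)
      qed
    qed
  next
    case (step b e)
    have b_dom: "b \<in> dom_of B" using step(1) B.Le_dom B_succ by blast
    have fe: "(f e, f b') \<in> Le A" using epimorphism_Le[OF f] step(2) by blast
    have bstep: "((b, c), (b', c')) \<in> ?S\<^sup>*"
      if "f e = f b" "(c, c') \<in> Le C" "f b = g c" for c
    proof -
      have "((b, c), (e, c)) \<in> ?S"
        using step(1) that B_succ C_refl C.Le_dom by (auto simp: fibre_step_def)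
      then show ?thesis
        using step.IH that by (simp add: converse_rtrancl_into_rtrancl)
    qed
    show ?case
    proof (intro allI impI)
      fix c assume "(c, c') \<in> Le C" "f b = g c"
      then show "((b, c), (b', c')) \<in> ?S\<^sup>*"
      proof (induction rule: C.Le_induct)
        case base
        \<comment> \<open>The walk in \<open>C\<close> has arrived, so
          \<open>f b = g c' = f b'\<close>, and \<open>f e\<close> is squeezed in between.\<close>
        have "(f b, f e) \<in> Le A" using step(1) B_succ epimorphism_Le[OF f] by blast
        then have "f e = f b" using fe base finish A.Le_antisym by metis
        then show ?case using bstep base c C.Le_refl C.Le_dom by blast
      next
        case (step c d)
        have gd: "(g d, g c') \<in> Le A" using epimorphism_Le[OF g] step(2) by blast
        have cc': "(c, c') \<in> Le C" using step(1,2) C_succ C.Le_trans by blast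
        consider "f e = f b" | "g d = g c" | "f e \<noteq> f b" "g d \<noteq> g c" by blast
        then show ?case
        proof cases
          case 1
          then show ?thesis using bstep cc' step by blast
        next
          case 2
          then have "((b, c), (b, d)) \<in> ?S"
            using step(1,4) C_succ B_refl[OF b_dom] by (auto simp: fibre_step_def)
          then show ?thesis using step 2 by (simp add: converse_rtrancl_into_rtrancl)
        next
          case 3
          then have "immediate_successor (Le A) (f b) (f e)" "immediate_successor (Le A) (f b) (g d)"
            using f_step g_step step(1,4) \<open>immediate_successor (Le B) b e\<close> by metis+
          then have eq: "f e = g d"
            using A.immediate_successor_unique_below fe gd finish by metis
          then have "((b, c), (e, d)) \<in> ?S"
            using \<open>immediate_successor (Le B) b e\<close> step(1,4) B_succ C_succ
            by (auto simp: fibre_step_def)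
          moreover have "((e, d), (b', c')) \<in> ?S\<^sup>*"
            using \<open>\<forall>c. (c, c') \<in> Le C \<longrightarrow> f e = g c \<longrightarrow> ((e, c), (b', c')) \<in> ?S\<^sup>*\<close> step(2) eq by blast
          ultimately show ?thesis by (rule converse_rtrancl_into_rtrancl)
        qed
      qed
    qed
  qed
  then show ?thesis using c start by blast
qed

section \<open>Disjoint sums of chains\<close>

text \<open>The label \<open>l x = (k, i)\<close> places \<open>x\<close> at height \<open>i\<close> of the chain with index \<open>k\<close>.\<close>

definition chain_sum :: "'a set \<Rightarrow> ('a \<Rightarrow> 'k \<times> nat) \<Rightarrow> 'a lr_structure" where
  "chain_sum X l = \<lparr>Top = discrete_topology X,
     Rel = {(x, y) \<in> X \<times> X. fst (l x) = fst (l y) \<and>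
       (snd (l x) = snd (l y) \<or> snd (l y) = Suc (snd (l x)) \<or> snd (l x) = Suc (snd (l y)))},
     Le = {(x, y) \<in> X \<times> X. fst (l x) = fst (l y) \<and> snd (l x) \<le> snd (l y)}\<rparr>"

lemma chain_sum_simps [simp]:
  "Top (chain_sum X l) = discrete_topology X"
  "(x, y) \<in> Rel (chain_sum X l) \<longleftrightarrow> x \<in> X \<and> y \<in> X \<and> fst (l x) = fst (l y) \<and>
     (snd (l x) = snd (l y) \<or> snd (l y) = Suc (snd (l x)) \<or> snd (l x) = Suc (snd (l y)))"
  "(x, y) \<in> Le (chain_sum X l) \<longleftrightarrow>
     x \<in> X \<and> y \<in> X \<and> fst (l x) = fst (l y) \<and> snd (l x) \<le> snd (l y)"
  by (auto simp: chain_sum_def)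

text \<open>Surjectivity of \<open>l\<close> onto the \<open>Sigma\<close> set leaves no gaps in the
  heights, so immediate successors are exactly the elements one higher in the same chain;
  injectivity gives antisymmetry.\<close>

lemma chain_sum_forest:
  assumes fin: "finite X" and ne: "X \<noteq> {}"
    and bij: "bij_betw l X (Sigma K (\<lambda>k. {..n k}))"
  shows "chain_sum X l \<in> finite_Hasse_forests"
proof -
  let ?P = "chain_sum X l"
  have inj: "x = y" if "x \<in> X" "y \<in> X" "fst (l x) = fst (l y)" "snd (l x) = snd (l y)" for x y
    using bij that unfolding bij_betw_def by (meson inj_onD prod_eqI)
  have po: "partial_order_on X (Le ?P)"
    unfolding partial_order_on_def preorder_on_def
    by (auto intro!: refl_onI transI antisymI inj)
  have succ: "immediate_successor (Le ?P) x y \<longleftrightarrow> fst (l x) = fst (l y) \<and> snd (l y) = Suc (snd (l x))"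
    if xy: "x \<in> X" "y \<in> X" for x y
  proof
    assume s: "immediate_successor (Le ?P) x y"
    then have le: "fst (l x) = fst (l y)" "snd (l x) \<le> snd (l y)" "x \<noteq> y"
      by (auto simp: immediate_successor_def)
    then have lt: "snd (l x) < snd (l y)" using inj xy by fastforce
    \<comment> \<open>The height just above \<open>x\<close> is occupied by some \<open>z\<close>.
      It lies between \<open>x\<close> and \<open>y\<close> and is higher than \<open>x\<close>, so
      it is \<open>y\<close>.\<close>
    have "l y \<in> Sigma K (\<lambda>k. {..n k})" using bij xy by (auto simp: bij_betw_def)
    then have "(fst (l y), Suc (snd (l x))) \<in> Sigma K (\<lambda>k. {..n k})" using lt by (cases "l y") auto
    then obtain z where z: "z \<in> X" "l z = (fst (l y), Suc (snd (l x)))"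
      using bij unfolding bij_betw_def by (metis imageE)
    then have "z = x \<or> z = y" using s xy le lt by (auto simp: immediate_successor_def)
    then have "snd (l x) = Suc (snd (l x)) \<or> snd (l y) = Suc (snd (l x))"
      using z(2) by (metis snd_conv)
    then show "fst (l x) = fst (l y) \<and> snd (l y) = Suc (snd (l x))" using le by simp
  next
    assume s: "fst (l x) = fst (l y) \<and> snd (l y) = Suc (snd (l x))"
    have "c = x \<or> c = y" if "(x, c) \<in> Le ?P" "(c, y) \<in> Le ?P" for c
      using that s inj[of c x] inj[of c y] by (auto simp: le_Suc_eq)
    moreover have "(x, y) \<in> Le ?P" "x \<noteq> y" using s xy by auto
    ultimately show "immediate_successor (Le ?P) x y"
      unfolding immediate_successor_def by blast
  qed
  have Rel: "(x, y) \<in> Rel ?P \<longleftrightarrow>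
      x = y \<or> immediate_successor (Le ?P) x y \<or> immediate_successor (Le ?P) y x"
    if "x \<in> X" "y \<in> X" for x y
    using that inj by (auto simp: succ)
  \<comment> \<open>Both neighbours of a highest vertex of a cycle would have to lie just below it.\<close>
  have False if cyc: "graph_cycle (Rel ?P) xs" for xs
  proof -
    let ?n = "length xs"
    have n: "3 \<le> ?n" and d: "distinct xs"
      and E: "\<And>i. i < ?n \<Longrightarrow> (xs ! i, xs ! (Suc i mod ?n)) \<in> Rel ?P"
      using cyc by (auto simp: graph_cycle_def)
    let ?H = "(\<lambda>x. snd (l x)) ` set xs"
    have "Max ?H \<in> ?H" using n by (intro Max_in) auto
    then obtain i where i: "i < ?n" "snd (l (xs ! i)) = Max ?H"
      by (auto simp: in_set_conv_nth)
    have top: "snd (l (xs ! j)) \<le> snd (l (xs ! i))" if "j < ?n" for j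
      unfolding i(2) using that by (intro Max_ge) auto
    \<comment> \<open>\<open>p\<close> and \<open>q\<close> are the cyclic neighbours of
      \<open>i\<close>; they differ because the cycle has at least three vertices.\<close>
    define p where "p = (if i = 0 then ?n - 1 else i - 1)"
    define q where "q = (if Suc i = ?n then 0 else Suc i)"
    have pq: "p < ?n" "q < ?n" "p \<noteq> q" "p \<noteq> i" "q \<noteq> i" "Suc p mod ?n = i" "Suc i mod ?n = q"
      using n i(1) by (auto simp: p_def q_def)
    have below: "snd (l (xs ! i)) = Suc (snd (l (xs ! j)))"
      if "j < ?n" "j \<noteq> i" "(xs ! i, xs ! j) \<in> Rel ?P \<or> (xs ! j, xs ! i) \<in> Rel ?P" for j
    proof -
      have "xs ! i \<noteq> xs ! j" using d that i(1) by (simp add: nth_eq_iff_index_eq)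
      then show ?thesis using that top[OF that(1)] inj[of "xs ! i" "xs ! j"] by auto
    qed
    have R: "(xs ! p, xs ! i) \<in> Rel ?P" "(xs ! i, xs ! q) \<in> Rel ?P"
      using E[OF pq(1)] E[OF i(1)] pq by auto
    have "Suc (snd (l (xs ! p))) = Suc (snd (l (xs ! q)))"
      using below[of p] below[of q] pq R by metis
    moreover have "xs ! p \<in> X" "xs ! q \<in> X" "fst (l (xs ! p)) = fst (l (xs ! q))"
      using R by simp_all
    ultimately have "xs ! p = xs ! q"
      using inj by blast
    then show False using d pq by (simp add: nth_eq_iff_index_eq)
  qed
  then show ?thesis
    using fin ne po Rel by (auto simp: finite_Hasse_forests_iff)
qed

text \<open>An index \<open>(m, w)\<close> stands for the walk \<open>w 0, \<dots>, w m\<close>; the values of \<open>w\<close> beyond \<open>m\<close> are junk.\<close>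

lemma chain_sum_epimorphism:
  assumes B: "B \<in> finite_Hasse_forests"
    and bij: "bij_betw l X (Sigma K (\<lambda>k. {..fst k}))"
    and steps: "\<And>m w i. (m, w) \<in> K \<Longrightarrow> i < m \<Longrightarrow> (\<pi> (w i), \<pi> (w (Suc i))) \<in> Rel B \<inter> Le B"
    and dom: "\<And>m w. (m, w) \<in> K \<Longrightarrow> \<pi> (w 0) \<in> dom_of B"
    and ends: "\<And>b b'. (b, b') \<in> Le B \<Longrightarrow> \<exists>(m, w)\<in>K. \<pi> (w 0) = b \<and> \<pi> (w m) = b'"
  shows "epimorphism (chain_sum X l) B (\<lambda>x. \<pi> (snd (fst (l x)) (snd (l x))))"
proof -
  interpret finite_Hasse_forest B by unfold_locales (rule B)
  let ?P = "chain_sum X l" and ?h = "\<lambda>x. \<pi> (snd (fst (l x)) (snd (l x)))"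
  have lX: "\<exists>m w i. l x = ((m, w), i) \<and> (m, w) \<in> K \<and> i \<le> m" if "x \<in> X" for x
  proof -
    have "l x \<in> Sigma K (\<lambda>k. {..fst k})" using bij that by (auto simp: bij_betw_def)
    then show ?thesis by (cases "l x") auto
  qed
  have at: "\<exists>x\<in>X. l x = ((m, w), i)" if "(m, w) \<in> K" "i \<le> m" for m w i
  proof -
    have "((m, w), i) \<in> l ` X" using bij that by (auto simp: bij_betw_def)
    then show ?thesis by (metis imageE)
  qed
  have walk_le: "(\<pi> (w i), \<pi> (w j)) \<in> Le B" if "(m, w) \<in> K" "i \<le> j" "j \<le> m" for m w i j
    using that(2,3)
  proof (induction j rule: dec_induct)
    case base
    \<comment> \<open>\<open>dom\<close> covers only the start of a walk; a later vertex is in the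
      carrier as the end of the step before it.\<close>
    have "\<pi> (w i) \<in> dom_of B"
    proof (cases i)
      case 0
      then show ?thesis using dom that(1) by simp
    next
      case (Suc j)
      then show ?thesis using steps[OF that(1), of j] base Le_dom by auto
    qed
    then show ?case by (rule Le_refl)
  next
    case (step j)
    then show ?case using steps[OF that(1), of j] Le_trans by auto
  qed
  have Le_sub: "(?h x, ?h y) \<in> Le B" if "(x, y) \<in> Le ?P" for x y
    using that lX[of x] lX[of y] walk_le by fastforce
  have Rel_sub: "(?h x, ?h y) \<in> Rel B" if xy: "(x, y) \<in> Rel ?P" for x y
  proof -
    have "x \<in> X" "y \<in> X" using xy by auto
    then obtain m w i m' w' j where l': "l x = ((m, w), i)" "l y = ((m', w'), j)"
      "(m, w) \<in> K" "i \<le> m" "j \<le> m'"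
      using lX[of x] lX[of y] by blast
    then have "(m', w') = (m, w)" using xy by simp
    then have l: "l x = ((m, w), i)" "l y = ((m, w), j)" "(m, w) \<in> K" "i \<le> m" "j \<le> m"
      using l' by simp_all
    consider "i = j" | "j = Suc i" | "i = Suc j" using xy l by auto
    then show ?thesis
    proof cases
      case 1
      then show ?thesis
        using l walk_le[OF l(3), of i i] Le_dom Rel_refl by auto
    next
      case 2
      then show ?thesis using l steps[OF l(3), of i] by auto
    next
      case 3
      then show ?thesis using l steps[OF l(3), of j] Rel_sym by auto
    qed
  qed
  have Le_sup: "\<exists>x y. (x, y) \<in> Le ?P \<and> ?h x = b \<and> ?h y = b'" if bb': "(b, b') \<in> Le B" for b b'
  proof -
    obtain m w where w: "(m, w) \<in> K" "\<pi> (w 0) = b" "\<pi> (w m) = b'" using ends[OF bb'] by blast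
    obtain x y where "x \<in> X" "l x = ((m, w), 0)" "y \<in> X" "l y = ((m, w), m)"
      using at[OF w(1)] by blast
    then show ?thesis using w by (intro exI[of _ x] exI[of _ y]) auto
  qed
  have succ_sup: "\<exists>x y. (x, y) \<in> Rel ?P \<and> (y, x) \<in> Rel ?P \<and> ?h x = b \<and> ?h y = b'"
    if s: "immediate_successor (Le B) b b'" for b b'
  proof -
    obtain m w where w: "(m, w) \<in> K" "\<pi> (w 0) = b" "\<pi> (w m) = b'"
      using ends[OF immediate_successor_Le[OF s]] by blast
    have ne: "b \<noteq> b'" using s by (simp add: immediate_successor_def)
    \<comment> \<open>The walk may pause at \<open>b\<close> or at \<open>b'\<close>, so adjacent
      positions over the two are found at the first arrival in \<open>b'\<close>: the vertex just
      before lies between \<open>b\<close> and \<open>b'\<close> and is not \<open>b'\<close>, hence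
      it is \<open>b\<close>.\<close>
    define j where "j = (LEAST j. \<pi> (w j) = b')"
    have j: "\<pi> (w j) = b'" unfolding j_def by (rule LeastI) (rule w(3))
    have jm: "j \<le> m" unfolding j_def by (rule Least_le) (rule w(3))
    obtain i where i: "j = Suc i" using j w(2) ne by (cases j) auto
    have "\<pi> (w i) \<noteq> b'" using i not_less_Least[of i "\<lambda>j. \<pi> (w j) = b'"] j_def by simp
    moreover have "(b, \<pi> (w i)) \<in> Le B" "(\<pi> (w i), b') \<in> Le B"
      using walk_le[OF w(1), of 0 i] walk_le[OF w(1), of i m] w i jm by auto
    ultimately have b: "\<pi> (w i) = b" using s by (auto simp: immediate_successor_def)
    obtain x y where "x \<in> X" "l x = ((m, w), i)" "y \<in> X" "l y = ((m, w), j)"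
      using at[OF w(1)] i jm by (meson Suc_leD)
    then show ?thesis using b j i by (intro exI[of _ x] exI[of _ y]) auto
  qed
  have Rel_sup: "\<exists>x y. (x, y) \<in> Rel ?P \<and> ?h x = b \<and> ?h y = b'" if bb': "(b, b') \<in> Rel B" for b b'
  proof -
    consider "b = b'" | "immediate_successor (Le B) b b'" | "immediate_successor (Le B) b' b"
      using Rel_iff Rel_dom bb' by blast
    then show ?thesis
    proof cases
      case 1
      then obtain x y where "(x, y) \<in> Le ?P" "?h x = b"
        using Le_sup[of b b] Le_refl Rel_dom bb' by blast
      then show ?thesis using 1 by (intro exI[of _ x]) auto
    qed (use succ_sup in blast)+
  qed
  show ?thesis
  proof (rule epimorphism_discreteI)
    show "?h x \<in> dom_of B" if "x \<in> X" for x
      using Le_sub[of x x] Le_dom that by simp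
    show "\<exists>x\<in>X. ?h x = b" if "b \<in> dom_of B" for b
      using Le_sup[OF Le_refl[OF that]] by (metis chain_sum_simps(3))
  qed (fact Rel_sub Le_sub Rel_sup Le_sup | simp)+
qed

section \<open>Amalgamation and joint projection\<close>

text \<open>The points of the amalgam are pairs of a walk and a height; this moves them into the
  element type shared by all structures of the family.\<close>

lemma finite_bij_betw_infinite_type:
  assumes "finite S"
  obtains X :: "'a::infinite set" and l where "finite X" "bij_betw l X S"
proof -
  obtain X :: "'a set" where "finite X" "card X = card S"
    using infinite_arbitrarily_large[OF infinite_UNIV, of "card S"] by blast
  then show thesis using that finite_same_card_bij assms by metis
qed

lemma finite_Hasse_forests_amalgamation:
  "projective_amalgamation_property (finite_Hasse_forests :: 'a::infinite lr_structure set)"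
  unfolding projective_amalgamation_property_def
proof (intro ballI allI impI)
  fix A B C :: "'a lr_structure" and f g
  assume A: "A \<in> finite_Hasse_forests" and B: "B \<in> finite_Hasse_forests"
    and C: "C \<in> finite_Hasse_forests" and fg: "epimorphism B A f \<and> epimorphism C A g"
  then have f: "epimorphism B A f" and g: "epimorphism C A g" by auto
  interpret B: finite_Hasse_forest B by unfold_locales (rule B)
  interpret C: finite_Hasse_forest C by unfold_locales (rule C)
  let ?S = "fibre_step B C f g"
  \<comment> \<open>The conditions on \<open>w 0\<close> place walks with \<open>m = 0\<close>,
    which have no step, in the fibre product too.\<close>
  define walk where "walk = (\<lambda>(m :: nat, w). (\<forall>i<m. (w i, w (Suc i)) \<in> ?S) \<and>
    fst (w 0) \<in> dom_of B \<and> snd (w 0) \<in> dom_of C \<and> f (fst (w 0)) = g (snd (w 0)))"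
  have walk_ex: "\<exists>m w. walk (m, w) \<and> w 0 = (b, c) \<and> w m = (b', c')"
    if h: "(b, b') \<in> Le B" "(c, c') \<in> Le C" "f b = g c" "f b' = g c'" for b b' c c'
  proof -
    have "((b, c), (b', c')) \<in> ?S\<^sup>*" by (rule fibre_walk_exists[OF A B C f g h])
    then obtain m where "((b, c), (b', c')) \<in> ?S ^^ m" using rtrancl_imp_relpow by blast
    then obtain w where "w 0 = (b, c)" "w m = (b', c')" "\<forall>i<m. (w i, w (Suc i)) \<in> ?S"
      unfolding relpow_fun_conv by blast
    then show ?thesis
      using h B.Le_dom C.Le_dom by (intro exI[of _ m] exI[of _ w]) (auto simp: walk_def)
  qed
  have "\<exists>k. walk k \<and> fst (snd k 0) = fst p \<and> fst (snd k (fst k)) = snd p" if "p \<in> Le B" for p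
  proof -
    obtain b b' where p: "p = (b, b')" by (cases p)
    \<comment> \<open>The image of the pair in \<open>Le A\<close> lifts along \<open>g\<close> to a
      pair in \<open>Le C\<close>, which supplies the second coordinates of the end points.\<close>
    obtain c c' where "(c, c') \<in> Le C" "g c = f b" "g c' = f b'"
      using epimorphism_Le_lift[OF g] epimorphism_Le[OF f] \<open>p \<in> Le B\<close> p by metis
    then obtain m w where "walk (m, w)" "w 0 = (b, c)" "w m = (b', c')"
      using walk_ex[of b b' c c'] \<open>p \<in> Le B\<close> p by auto
    then show ?thesis using p by (intro exI[of _ "(m, w)"]) auto
  qed
  \<comment> \<open>Fixing one walk per pair keeps the index set \<open>K\<close> finite, although
    there are infinitely many walks.\<close>
  then obtain F where F: "\<And>p. p \<in> Le B \<Longrightarrow>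
      walk (F p) \<and> fst (snd (F p) 0) = fst p \<and> fst (snd (F p) (fst (F p))) = snd p"
    by metis
  have "\<exists>k. walk k \<and> snd (snd k 0) = fst p \<and> snd (snd k (fst k)) = snd p" if "p \<in> Le C" for p
  proof -
    obtain c c' where p: "p = (c, c')" by (cases p)
    obtain b b' where "(b, b') \<in> Le B" "f b = g c" "f b' = g c'"
      using epimorphism_Le_lift[OF f] epimorphism_Le[OF g] \<open>p \<in> Le C\<close> p by metis
    then obtain m w where "walk (m, w)" "w 0 = (b, c)" "w m = (b', c')"
      using walk_ex[of b b' c c'] \<open>p \<in> Le C\<close> p by auto
    then show ?thesis using p by (intro exI[of _ "(m, w)"]) auto
  qed
  then obtain G where G: "\<And>p. p \<in> Le C \<Longrightarrow>
      walk (G p) \<and> snd (snd (G p) 0) = fst p \<and> snd (snd (G p) (fst (G p))) = snd p"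
    by metis
  define K where "K = F ` Le B \<union> G ` Le C"
  have "finite (Sigma K (\<lambda>k. {..fst k}))"
    using B.finite_Le C.finite_Le by (auto simp: K_def)
  then obtain X :: "'a set" and l where X: "finite X" "bij_betw l X (Sigma K (\<lambda>k. {..fst k}))"
    by (rule finite_bij_betw_infinite_type)
  obtain b where "b \<in> dom_of B" using B.nonempty by blast
  then have "K \<noteq> {}" using B.Le_refl unfolding K_def by blast
  then have X_ne: "X \<noteq> {}" using X(2) by (auto simp: bij_betw_def)
  have walk_K: "walk k" if "k \<in> K" for k using that F G by (auto simp: K_def)
  have agree: "f (fst (w i)) = g (snd (w i))" if "(m, w) \<in> K" "i \<le> m" for m w i
  proof (cases i)
    case 0
    then show ?thesis using walk_K[OF that(1)] by (simp add: walk_def)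
  next
    case (Suc j)
    then have "(w j, w i) \<in> ?S" using walk_K[OF that(1)] that(2) by (simp add: walk_def)
    then show ?thesis by (auto simp: fibre_step_def)
  qed
  have step_K: "(w i, w (Suc i)) \<in> ?S" if "(m, w) \<in> K" "i < m" for m w i
    using walk_K[OF that(1)] that(2) by (simp add: walk_def)
  have D: "chain_sum X l \<in> finite_Hasse_forests"
    by (rule chain_sum_forest[OF X(1) X_ne X(2)])
  have epiB: "epimorphism (chain_sum X l) B (\<lambda>x. fst (snd (fst (l x)) (snd (l x))))"
  proof (rule chain_sum_epimorphism[OF B X(2)])
    show "(fst (w i), fst (w (Suc i))) \<in> Rel B \<inter> Le B" if "(m, w) \<in> K" "i < m" for m w i
      using step_K[OF that] by (auto simp: fibre_step_def)
    show "fst (w 0) \<in> dom_of B" if "(m, w) \<in> K" for m w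
      using walk_K[OF that] by (simp add: walk_def)
    show "\<exists>(m, w)\<in>K. fst (w 0) = b \<and> fst (w m) = b'" if "(b, b') \<in> Le B" for b b'
      using F[OF that] that unfolding K_def by (intro bexI[of _ "F (b, b')"]) auto
  qed
  have epiC: "epimorphism (chain_sum X l) C (\<lambda>x. snd (snd (fst (l x)) (snd (l x))))"
  proof (rule chain_sum_epimorphism[OF C X(2)])
    show "(snd (w i), snd (w (Suc i))) \<in> Rel C \<inter> Le C" if "(m, w) \<in> K" "i < m" for m w i
      using step_K[OF that] by (auto simp: fibre_step_def)
    show "snd (w 0) \<in> dom_of C" if "(m, w) \<in> K" for m w
      using walk_K[OF that] by (simp add: walk_def)
    show "\<exists>(m, w)\<in>K. snd (w 0) = c \<and> snd (w m) = c'" if "(c, c') \<in> Le C" for c c'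
      using G[OF that] that unfolding K_def by (intro bexI[of _ "G (c, c')"]) auto
  qed
  have "f (fst (snd (fst (l x)) (snd (l x)))) = g (snd (snd (fst (l x)) (snd (l x))))"
    if "x \<in> X" for x
  proof -
    have "l x \<in> Sigma K (\<lambda>k. {..fst k})" using X(2) that by (auto simp: bij_betw_def)
    then show ?thesis using agree by (cases "l x") auto
  qed
  then show "\<exists>D\<in>finite_Hasse_forests :: 'a lr_structure set.
      \<exists>p q. epimorphism D B p \<and> epimorphism D C q \<and>
      (\<forall>d\<in>dom_of D. f (p d) = g (q d))"
    using D epiB epiC by (intro bexI[of _ "chain_sum X l"] exI conjI) auto
qed

text \<open>Constant maps onto a one-point forest are epimorphisms because forests are nonempty and
  both relations are reflexive.\<close>

lemma finite_Hasse_forests_joint_projection: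
  "joint_projection_property (finite_Hasse_forests :: 'a::infinite lr_structure set)"
  unfolding joint_projection_property_def
proof (intro ballI)
  fix A B :: "'a lr_structure"
  assume A: "A \<in> finite_Hasse_forests" and B: "B \<in> finite_Hasse_forests"
  fix pt :: 'a
  \<comment> \<open>A single chain whose only height is 0.\<close>
  define T where "T = chain_sum {pt} (\<lambda>_. ((), 0))"
  have T: "T \<in> finite_Hasse_forests"
    unfolding T_def
    by (rule chain_sum_forest[where K = "{()}" and n = "\<lambda>_. 0"]) (auto simp: bij_betw_def)
  have "epimorphism P T (\<lambda>_. pt)" if P: "P \<in> finite_Hasse_forests" for P :: "'a lr_structure"
  proof -
    interpret finite_Hasse_forest P by unfold_locales (rule P)
    obtain a where a: "a \<in> dom_of P" using nonempty by blast
    have "Rel T = {(pt, pt)}" "Le T = {(pt, pt)}" by (auto simp: T_def)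
    then show ?thesis
      using a Le_refl[OF a] Rel_refl[OF a] by (auto simp: epimorphism_def T_def image_iff)
  qed
  then have "epimorphism A T (\<lambda>_. pt) \<and> epimorphism B T (\<lambda>_. pt)"
    using A B by blast
  from finite_Hasse_forests_amalgamation[unfolded projective_amalgamation_property_def,
      rule_format, OF T A B this]
  show "\<exists>C\<in>finite_Hasse_forests :: 'a lr_structure set. \<exists>f g. epimorphism C A f \<and> epimorphism C B g"
    by blast
qed

theorem theorem3p6:
  shows "projective_Fraisse_family (finite_Hasse_forests :: 'a::infinite lr_structure set)"
  unfolding projective_Fraisse_family_def
  using finite_Hasse_forests_joint_projection finite_Hasse_forests_amalgamation
  by (auto simp: finite_Hasse_forests_def Hasse_forest_def HPO_def)

end
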